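(* Let $n$ be a positive integer. Any domino tiling of the Aztec diamond of order $n$ can be reached from any other domino tiling of the Aztec diamond of order $n$ by a finite sequence of elementary moves.
   Context: The Aztec diamond of order $n$ is the union of those lattice squares $[a,a+1]\times[b,b+1]\subset\mathbb{R}^2$ ($a,b\in\mathbb{Z}$) that lie completely inside the tilted square $\{(x,y): |x|+|y|\le n+1\}$. A domino is a closed $1\times 2$ or $2\times 1$ rectangle in $\mathbb{R}^2$ with corners in $\mathbb{Z}^2$. A tiling of a region $R$ by dominoes is a set of dominoes whose interiors are disjoint and whose union is $R$. An elementary move converts one domino tiling of a region into another by removing two dominoes that together form a $2\times 2$ block and putting them back rotated by 90 degrees (so two horizontal dominoes filling the block are replaced by two vertical ones, or vice versa). *)

theory Defs
  imports "HOL-Analysis.Analysis"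
begin

definition lattice_square :: "int \<Rightarrow> int \<Rightarrow> (real \<times> real) set" where
  "lattice_square a b = {of_int a..of_int a + 1} \<times> {of_int b..of_int b + 1}"

definition aztec_diamond :: "nat \<Rightarrow> (real \<times> real) set" where
  "aztec_diamond n =
     \<Union> {lattice_square a b | a b.
          lattice_square a b \<subseteq> {(x, y). \<bar>x\<bar> + \<bar>y\<bar> \<le> real n + 1}}"

text \<open>Horizontal and vertical dominoes, indexed by their lower left corner.\<close>

definition hdomino :: "int \<Rightarrow> int \<Rightarrow> (real \<times> real) set" where
  "hdomino a b = {of_int a..of_int a + 2} \<times> {of_int b..of_int b + 1}"

definition vdomino :: "int \<Rightarrow> int \<Rightarrow> (real \<times> real) set" where
  "vdomino a b = {of_int a..of_int a + 1} \<times> {of_int b..of_int b + 2}"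

definition dominoes :: "(real \<times> real) set set" where
  "dominoes = {hdomino a b | a b. True} \<union> {vdomino a b | a b. True}"

definition domino_tiling :: "(real \<times> real) set \<Rightarrow> (real \<times> real) set set \<Rightarrow> bool" where
  "domino_tiling R T \<longleftrightarrow>
     T \<subseteq> dominoes \<and>
     pairwise (\<lambda>d e. interior d \<inter> interior e = {}) T \<and>
     \<Union> T = R"

text \<open>The two ways of filling the \<open>2 \<times> 2\<close> block with lower left corner \<open>(a, b)\<close>.\<close>

definition hpair :: "int \<Rightarrow> int \<Rightarrow> (real \<times> real) set set" where
  "hpair a b = {hdomino a b, hdomino a (b + 1)}"

definition vpair :: "int \<Rightarrow> int \<Rightarrow> (real \<times> real) set set" where
  "vpair a b = {vdomino a b, vdomino (a + 1) b}"

definition elementary_move ::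
  "(real \<times> real) set \<Rightarrow> (real \<times> real) set set \<Rightarrow> (real \<times> real) set set \<Rightarrow> bool" where
  "elementary_move R T T' \<longleftrightarrow>
     domino_tiling R T \<and> domino_tiling R T' \<and>
     (\<exists>a b. (hpair a b \<subseteq> T \<and> T' = (T - hpair a b) \<union> vpair a b) \<or>
            (vpair a b \<subseteq> T \<and> T' = (T - vpair a b) \<union> hpair a b))"

end

theory Submission
  imports Defs
begin

text \<open>
  The proof is Thurston's height function argument, made explicit for the Aztec diamond.

  Colour the unit cells like a chessboard. For a tiling \<open>T\<close>, let the flux at a lattice vertex
  \<open>(x, y)\<close> be the signed number of vertical dominoes that cross the horizontal line through the
  vertex to its left. Since every cell is covered exactly once, the flux at two vertically adjacent
  vertices differs by the sign of a horizontal domino that may separate them, plus a term depending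
  only on the region (\<open>flux_conservation\<close>). Consequently the flux determines the tiling
  (\<open>tiling_eq_if_flux_eq\<close>), and the difference of the fluxes of two tilings vanishes at every
  vertex that is not interior to the diamond (\<open>flux_diff_support\<close>).

  Adding a correction that is the same for all tilings turns the flux into a height, which rises
  by 2 or falls by 6 along each suitably oriented edge, falling exactly when a domino straddles the
  edge. Suppose the flux of \<open>T\<close> exceeds that of \<open>T'\<close> somewhere, and choose among all such vertices
  one where \<open>T\<close> is highest. An outgoing edge not straddled by \<open>T\<close> would lead to a higher
  vertex, and along such an edge the excess of \<open>T\<close> over \<open>T'\<close> cannot shrink, because \<open>T'\<close> rises no
  faster than \<open>T\<close>. So both outgoing edges are straddled, and the two dominoes form a
  \<open>2 \<times> 2\<close> block around the vertex (\<open>highest_vertex_block\<close>). Rotating this block lowers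
  the flux by 1 at that vertex and changes it nowhere else (\<open>flux_block_flip\<close>), so it brings
  \<open>T\<close> strictly closer to \<open>T'\<close>. If the flux of \<open>T\<close> is nowhere larger, the same argument
  moves \<open>T'\<close> closer to \<open>T\<close>; moves being reversible, induction on the total flux
  difference connects the two tilings.
\<close>

section \<open>Dominoes and cells\<close>

text \<open>Cell centers lie on the boundary of no domino. Testing membership of centers therefore
  reduces covering and disjointness of real rectangles to statements about integers.\<close>

definition center :: "int \<Rightarrow> int \<Rightarrow> real \<times> real" where
  "center a b = (of_int a + 1/2, of_int b + 1/2)"

text \<open>On \<open>[a, a + 1]\<close> the maximum of \<open>\<bar>x\<bar>\<close> is \<open>(\<bar>2 * a + 1\<bar> + 1) / 2\<close>, so this is the condition
  that the farthest corner of the cell still lies in the tilted square.\<close>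

definition aztec_cell :: "nat \<Rightarrow> int \<Rightarrow> int \<Rightarrow> bool" where
  "aztec_cell n a b \<longleftrightarrow> \<bar>2 * a + 1\<bar> + \<bar>2 * b + 1\<bar> \<le> 2 * int n"

lemma aztec_cell_mono: "aztec_cell n a b \<Longrightarrow> \<bar>2 * i + 1\<bar> \<le> \<bar>2 * a + 1\<bar> \<Longrightarrow> aztec_cell n i b"
  unfolding aztec_cell_def by (rule order_trans[OF add_right_mono])

text \<open>The bound says that the edge from \<open>(x, y)\<close> to \<open>(x, y + 1)\<close> belongs to row \<open>y\<close>, its two ends
  included; this is the form in which induction along the row uses it.\<close>

lemma inner_edge_bound:
  assumes "aztec_cell n x y" "aztec_cell n (x - 1) y"
  shows "2 * \<bar>x\<bar> + \<bar>2 * y + 1\<bar> \<le> 2 * int n + 1"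
proof -
  have "2 * \<bar>x\<bar> + r \<le> m + 1" if "\<bar>2 * x + 1\<bar> + r \<le> m" "\<bar>2 * (x - 1) + 1\<bar> + r \<le> m" for r m
    using that by linarith
  then show ?thesis using assms unfolding aztec_cell_def by blast
qed

lemma aztec_cell_bounds:
  assumes "aztec_cell n a b"
  shows "- int n \<le> a" "a < int n" "- int n \<le> b" "b < int n"
proof -
  have bound: "- m \<le> c \<and> c < m" if "\<bar>2 * c + 1\<bar> + \<bar>r\<bar> \<le> 2 * m" for c r m :: int
  proof -
    have "\<bar>2 * c + 1\<bar> \<le> 2 * m" using that abs_ge_zero[of r] by simp
    then show ?thesis by (simp add: abs_le_iff)
  qed
  show "- int n \<le> a" "a < int n"
    using bound[of a "2 * b + 1" "int n"] assms unfolding aztec_cell_def by blast+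
  show "- int n \<le> b" "b < int n"
    using bound[of b "2 * a + 1" "int n"] assms unfolding aztec_cell_def by (simp_all add: add.commute)
qed

lemma half_between_iff:
  fixes a x :: int
  shows "of_int a \<le> of_int x + (1/2::real) \<longleftrightarrow> a \<le> x"
    and "of_int x + (1/2::real) \<le> of_int a + 1 \<longleftrightarrow> x \<le> a"
    and "of_int x + (1/2::real) \<le> of_int a + 2 \<longleftrightarrow> x \<le> a + 1"
  by linarith+

lemma center_in_lattice_square: "center x y \<in> lattice_square a b \<longleftrightarrow> x = a \<and> y = b"
  unfolding center_def lattice_square_def by (auto simp: half_between_iff)

lemma center_in_hdomino: "center x y \<in> hdomino a b \<longleftrightarrow> (x = a \<or> x = a + 1) \<and> y = b"
  unfolding center_def hdomino_def by (auto simp: half_between_iff)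

lemma center_in_vdomino: "center x y \<in> vdomino a b \<longleftrightarrow> x = a \<and> (y = b \<or> y = b + 1)"
  unfolding center_def vdomino_def by (auto simp: half_between_iff)

lemmas center_in_domino = center_in_hdomino center_in_vdomino

lemma hdomino_eq_iff [simp]: "hdomino a b = hdomino a' b' \<longleftrightarrow> a = a' \<and> b = b'"
  by (metis center_in_hdomino add_cancel_right_right zero_neq_one add_left_cancel add.assoc
      add_diff_cancel_right' one_add_one zero_neq_numeral)

lemma vdomino_eq_iff [simp]: "vdomino a b = vdomino a' b' \<longleftrightarrow> a = a' \<and> b = b'"
  by (metis center_in_vdomino add_cancel_right_right zero_neq_one add_left_cancel add.assoc
      add_diff_cancel_right' one_add_one zero_neq_numeral)

lemma hdomino_neq_vdomino [simp]: "hdomino a b \<noteq> vdomino a' b'" "vdomino a' b' \<noteq> hdomino a b"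
  by (metis center_in_hdomino center_in_vdomino add_cancel_right_right zero_neq_one)+

lemma dominoes_cases:
  assumes "d \<in> dominoes"
  obtains a b where "d = hdomino a b" | a b where "d = vdomino a b"
  using assms unfolding dominoes_def by auto

lemma in_dominoes [simp]: "hdomino a b \<in> dominoes" "vdomino a b \<in> dominoes"
  unfolding dominoes_def by auto

lemma interior_hdomino: "interior (hdomino a b) = {of_int a<..<of_int a + 2} \<times> {of_int b<..<of_int b + 1}"
  unfolding hdomino_def by (simp add: interior_Times)

lemma interior_vdomino: "interior (vdomino a b) = {of_int a<..<of_int a + 1} \<times> {of_int b<..<of_int b + 2}"
  unfolding vdomino_def by (simp add: interior_Times)

lemma center_in_interior:
  assumes "d \<in> dominoes" "center x y \<in> d"
  shows "center x y \<in> interior d"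
  using assms(1)
proof (cases rule: dominoes_cases)
  case (1 a b)
  then show ?thesis using assms(2)
    by (auto simp: center_in_hdomino interior_hdomino) (auto simp: center_def)
next
  case (2 a b)
  then show ?thesis using assms(2)
    by (auto simp: center_in_vdomino interior_vdomino) (auto simp: center_def)
qed

lemma ceiling_in_double_interval:
  fixes r :: real
  assumes "of_int a < r" "r < of_int a + 2"
  shows "\<lceil>r\<rceil> - 1 = a \<or> \<lceil>r\<rceil> - 1 = a + 1"
  using assms by linarith

lemma ceiling_in_unit_interval: "of_int a < r \<Longrightarrow> r < of_int a + 1 \<Longrightarrow> \<lceil>r\<rceil> - 1 = a" for r :: real
  by linarith

text \<open>Overlapping dominoes share a whole cell, because their corners are integral.\<close>

lemma interiors_disjoint_iff:
  assumes "d \<in> dominoes" "e \<in> dominoes"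
  shows "interior d \<inter> interior e = {} \<longleftrightarrow> (\<nexists>x y. center x y \<in> d \<and> center x y \<in> e)"
proof
  assume "interior d \<inter> interior e = {}"
  then show "\<nexists>x y. center x y \<in> d \<and> center x y \<in> e"
    using assms center_in_interior by blast
next
  assume *: "\<nexists>x y. center x y \<in> d \<and> center x y \<in> e"
  \<comment> \<open>A common interior point may lie on a grid line; rounding up and subtracting 1 selects the cell
    on its lower left, which every domino with that interior point contains.\<close>
  have key: "center (\<lceil>r\<rceil> - 1) (\<lceil>s\<rceil> - 1) \<in> c" if "c \<in> dominoes" "(r, s) \<in> interior c" for c r s
    using that(1)
  proof (cases rule: dominoes_cases)
    case (1 a b)
    then show ?thesis using that(2) ceiling_in_double_interval[of a r] ceiling_in_unit_interval[of b s]
      by (auto simp: center_in_hdomino interior_hdomino)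
  next
    case (2 a b)
    then show ?thesis using that(2) ceiling_in_double_interval[of b s] ceiling_in_unit_interval[of a r]
      by (auto simp: center_in_vdomino interior_vdomino)
  qed
  show "interior d \<inter> interior e = {}"
    using key[OF assms(1)] key[OF assms(2)] * by fastforce
qed

lemma center_in_aztec_diamond: "center a b \<in> aztec_diamond n \<longleftrightarrow> aztec_cell n a b"
proof
  assume "center a b \<in> aztec_diamond n"
  then have sub: "lattice_square a b \<subseteq> {(x, y). \<bar>x\<bar> + \<bar>y\<bar> \<le> real n + 1}"
    unfolding aztec_diamond_def by (auto simp: center_in_lattice_square)
  have "\<bar>of_int i\<bar> + \<bar>of_int j\<bar> \<le> real n + 1"
    if "i = a \<or> i = a + 1" "j = b \<or> j = b + 1" for i j :: int
  proof -
    have "(of_int i, of_int j) \<in> lattice_square a b"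
      using that unfolding lattice_square_def by auto
    then show ?thesis using sub by blast
  qed
  then have "\<bar>i\<bar> + \<bar>j\<bar> \<le> int n + 1"
    if "i = a \<or> i = a + 1" "j = b \<or> j = b + 1" for i j :: int
    using that by (metis (mono_tags, opaque_lifting) of_int_1 of_int_abs of_int_add of_int_le_iff
        of_int_of_nat_eq)
  note corner = this
  \<comment> \<open>The corner coordinate farther from the origin attains the bound in the definition of
    the cells.\<close>
  have "\<exists>i. (i = c \<or> i = c + 1) \<and> 2 * \<bar>i\<bar> = \<bar>2 * c + 1\<bar> + 1" for c :: int
    by (rule exI[of _ "if c \<ge> 0 then c + 1 else c"]) auto
  then obtain i j where "i = a \<or> i = a + 1" "2 * \<bar>i\<bar> = \<bar>2 * a + 1\<bar> + 1"
    "j = b \<or> j = b + 1" "2 * \<bar>j\<bar> = \<bar>2 * b + 1\<bar> + 1"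
    by metis
  with corner[of i j] show "aztec_cell n a b" unfolding aztec_cell_def by simp
next
  assume c: "aztec_cell n a b"
  then have "\<bar>2 * real_of_int a + 1\<bar> + \<bar>2 * real_of_int b + 1\<bar> \<le> 2 * real n"
    unfolding aztec_cell_def by linarith
  then have "lattice_square a b \<subseteq> {(x, y). \<bar>x\<bar> + \<bar>y\<bar> \<le> real n + 1}"
    unfolding lattice_square_def by auto
  then show "center a b \<in> aztec_diamond n"
    unfolding aztec_diamond_def using center_in_lattice_square by blast
qed

section \<open>Tilings and moves\<close>

lemma domino_tiling_iff:
  "domino_tiling R T \<longleftrightarrow> T \<subseteq> dominoes \<and> \<Union> T = R \<and>
     (\<forall>d\<in>T. \<forall>e\<in>T. \<forall>x y. center x y \<in> d \<longrightarrow> center x y \<in> e \<longrightarrow> d = e)"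
proof (cases "T \<subseteq> dominoes")
  case True
  then have "interior d \<inter> interior e = {} \<longleftrightarrow> (\<nexists>x y. center x y \<in> d \<and> center x y \<in> e)"
    if "d \<in> T" "e \<in> T" for d e
    using that interiors_disjoint_iff by blast
  then show ?thesis unfolding domino_tiling_def pairwise_def by (metis (no_types, lifting))
qed (simp add: domino_tiling_def)

lemma tiling_unique:
  assumes "domino_tiling R T" "d \<in> T" "e \<in> T" "center x y \<in> d" "center x y \<in> e"
  shows "d = e"
  using assms unfolding domino_tiling_iff by blast

text \<open>The exact cover condition as one integer equation; multiplied by the colour of the cell
  and summed over a row, it yields the conservation law for the flux.\<close>

lemma cell_covered_once:
  assumes "domino_tiling (aztec_diamond n) T"
  shows "of_bool (hdomino a b \<in> T) + of_bool (hdomino (a - 1) b \<in> T)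
       + of_bool (vdomino a b \<in> T) + of_bool (vdomino a (b - 1) \<in> T)
       = (of_bool (aztec_cell n a b) :: int)"
proof -
  define S where "S = {hdomino a b, hdomino (a - 1) b, vdomino a b, vdomino a (b - 1)}"
  have T: "T \<subseteq> dominoes" "\<Union> T = aztec_diamond n"
    using assms unfolding domino_tiling_def by auto
  have "d \<in> S \<longleftrightarrow> center a b \<in> d" if "d \<in> dominoes" for d
    using that by (cases rule: dominoes_cases) (auto simp: center_in_domino S_def)
  then have in_S: "d \<in> S \<longleftrightarrow> center a b \<in> d" if "d \<in> T" for d
    using that T(1) by blast
  have "(\<exists>d\<in>T. d \<in> S) \<longleftrightarrow> aztec_cell n a b"
    unfolding center_in_aztec_diamond[symmetric] T(2)[symmetric] using in_S by auto
  then have ex: "hdomino a b \<in> T \<or> hdomino (a - 1) b \<in> T \<or> vdomino a b \<in> T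
    \<or> vdomino a (b - 1) \<in> T \<longleftrightarrow> aztec_cell n a b"
    unfolding S_def by auto
  have "d = e" if "d \<in> T" "e \<in> T" "d \<in> S" "e \<in> S" for d e
    using tiling_unique[OF assms that(1,2)] that in_S by blast
  note uniq = this[unfolded S_def]
  have "\<not> (hdomino a b \<in> T \<and> hdomino (a - 1) b \<in> T)"
    "\<not> (hdomino a b \<in> T \<and> vdomino a b \<in> T)"
    "\<not> (hdomino a b \<in> T \<and> vdomino a (b - 1) \<in> T)"
    "\<not> (hdomino (a - 1) b \<in> T \<and> vdomino a b \<in> T)"
    "\<not> (hdomino (a - 1) b \<in> T \<and> vdomino a (b - 1) \<in> T)"
    "\<not> (vdomino a b \<in> T \<and> vdomino a (b - 1) \<in> T)"
    using uniq[of "hdomino a b" "hdomino (a-1) b"] uniq[of "hdomino a b" "vdomino a b"]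
      uniq[of "hdomino a b" "vdomino a (b-1)"] uniq[of "hdomino (a-1) b" "vdomino a b"]
      uniq[of "hdomino (a-1) b" "vdomino a (b-1)"] uniq[of "vdomino a b" "vdomino a (b-1)"]
    by auto
  then show ?thesis using ex by (auto simp: of_bool_def)
qed

lemma tiling_cells:
  assumes "domino_tiling (aztec_diamond n) T"
  shows "hdomino a b \<in> T \<Longrightarrow> aztec_cell n a b \<and> aztec_cell n (a + 1) b"
    and "vdomino a b \<in> T \<Longrightarrow> aztec_cell n a b \<and> aztec_cell n a (b + 1)"
proof -
  have "aztec_cell n x y" if "d \<in> T" "center x y \<in> d" for d x y
    using that assms center_in_aztec_diamond unfolding domino_tiling_def by blast
  then show "hdomino a b \<in> T \<Longrightarrow> aztec_cell n a b \<and> aztec_cell n (a + 1) b"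
    and "vdomino a b \<in> T \<Longrightarrow> aztec_cell n a b \<and> aztec_cell n a (b + 1)"
    by (meson center_in_domino)+
qed

lemma Union_hpair_vpair: "\<Union> (hpair a b) = \<Union> (vpair a b)"
  unfolding hpair_def vpair_def hdomino_def vdomino_def by auto

text \<open>Disjointness of the new dominoes from the remaining ones needs no geometry: a shared center
  would lie in some domino of \<open>P\<close> as well, and \<open>T\<close> covers it only once.\<close>

lemma exchange_tiling:
  assumes T: "domino_tiling R T" and "P \<subseteq> T" "Q \<subseteq> dominoes" "\<Union> P = \<Union> Q"
    and Q: "\<And>d e x y. d \<in> Q \<Longrightarrow> e \<in> Q \<Longrightarrow> center x y \<in> d \<Longrightarrow> center x y \<in> e \<Longrightarrow> d = e"
  shows "domino_tiling R ((T - P) \<union> Q)"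
proof -
  have sep: "center x y \<notin> e" if "d \<in> T" "d \<notin> P" "e \<in> Q" "center x y \<in> d" for d e x y
  proof
    assume "center x y \<in> e"
    then have "center x y \<in> \<Union> P" using that(3) assms(4) by (metis UnionI)
    then obtain p where p: "p \<in> P" "center x y \<in> p" by (rule UnionE)
    then have "d = p" using tiling_unique[OF T that(1) _ that(4)] assms(2) by (metis subsetD)
    then show False using p(1) that(2) by simp
  qed
  have unique: "d = e" if "d \<in> (T - P) \<union> Q" "e \<in> (T - P) \<union> Q"
    "center x y \<in> d" "center x y \<in> e" for d e x y
    using that sep Q tiling_unique[OF T, of d e] by (metis DiffE UnE)
  have "\<Union> T = \<Union> (T - P) \<union> \<Union> P"
    using assms(2) by (metis Diff_partition Un_commute Union_Un_distrib)
  then have union: "\<Union> ((T - P) \<union> Q) = R"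
    using T assms(4) by (simp add: domino_tiling_def)
  have "(T - P) \<union> Q \<subseteq> dominoes"
    using T assms(3) by (auto simp: domino_tiling_def)
  with unique union show ?thesis
    unfolding domino_tiling_iff by metis
qed

text \<open>Moves are reversible: the rotated pair covers the same cells as the removed one, hence
  shares no domino with \<open>T\<close>, and rotating back restores exactly \<open>T\<close>.\<close>

lemma flip_moves:
  assumes T: "domino_tiling R T"
    and PQ: "P = hpair a b \<and> Q = vpair a b \<or> P = vpair a b \<and> Q = hpair a b"
    and P: "P \<subseteq> T"
  shows "elementary_move R T ((T - P) \<union> Q)" "elementary_move R ((T - P) \<union> Q) T"
    and "Q \<inter> T = {}"
proof -
  have Q: "Q \<subseteq> dominoes" "\<Union> P = \<Union> Q"
    using PQ Union_hpair_vpair[of a b] by (auto simp: hpair_def vpair_def)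
  have Q_uniq: "d = e" if "d \<in> Q" "e \<in> Q" "center x y \<in> d" "center x y \<in> e" for d e x y
    using that PQ by (auto simp: hpair_def vpair_def center_in_domino)
  have tiling': "domino_tiling R ((T - P) \<union> Q)"
    by (rule exchange_tiling[OF T P Q]) (rule Q_uniq)
  show "elementary_move R T ((T - P) \<union> Q)"
    unfolding elementary_move_def using T tiling' PQ P by blast
  have disj: "P \<inter> Q = {}" using PQ by (auto simp: hpair_def vpair_def)
  have "q \<notin> T" if q: "q \<in> Q" for q
  proof
    assume "q \<in> T"
    have "\<exists>x y. center x y \<in> q"
      using q PQ by (auto simp: hpair_def vpair_def center_in_domino)
    then obtain x y where "center x y \<in> q" by blast
    moreover from this obtain p where "p \<in> P" "center x y \<in> p" using Q(2) q by blast
    ultimately have "p = q" using tiling_unique[OF T] \<open>q \<in> T\<close> P by blast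
    then show False using disj \<open>p \<in> P\<close> q by blast
  qed
  then show Q_T: "Q \<inter> T = {}" by blast
  then have "T = ((T - P) \<union> Q) - Q \<union> P" using P by blast
  then show "elementary_move R ((T - P) \<union> Q) T"
    unfolding elementary_move_def using T tiling' PQ by blast
qed

section \<open>Flux and height\<close>

text \<open>The shift by \<open>n\<close> gives the leftmost cell of every row in the upper half colour 1, and that
  of every row in the lower half colour -1, whatever the parity of \<open>n\<close>.\<close>

definition color :: "nat \<Rightarrow> int \<Rightarrow> int \<Rightarrow> int" where
  "color n a b = (if even (a + b + int n) then 1 else -1)"

text \<open>The vertical domino with lower left corner \<open>(a, y - 1)\<close> is the one crossing the line at
  height \<open>y\<close>; it is counted with the colour of its upper cell. The sum may start at \<open>- n\<close> since no
  cell of the diamond lies further left.\<close>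

definition flux :: "nat \<Rightarrow> (real \<times> real) set set \<Rightarrow> int \<Rightarrow> int \<Rightarrow> int" where
  "flux n T x y = (\<Sum>a\<in>{- int n..<x}. color n a y * of_bool (vdomino a (y - 1) \<in> T))"

lemma color_shift [simp]:
  "color n (a + 1) b = - color n a b" "color n (1 + a) b = - color n a b"
  "color n (a - 1) b = - color n a b"
  "color n a (b + 1) = - color n a b" "color n a (1 + b) = - color n a b"
  "color n a (b - 1) = - color n a b"
  unfolding color_def by auto

lemma sum_int_step:
  fixes f :: "int \<Rightarrow> int"
  assumes "m \<le> x"
  shows "sum f {m..<x + 1} = sum f {m..<x} + f x"
proof -
  have "{m..<x + 1} = insert x {m..<x}" using assms by auto
  then show ?thesis by simp
qed

text \<open>The colour imbalance of the cells of row \<open>y\<close> to the left of \<open>x\<close>, the contribution of the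
  region alone to the conservation law.\<close>

definition row_excess :: "nat \<Rightarrow> int \<Rightarrow> int \<Rightarrow> int" where
  "row_excess n x y = (\<Sum>a\<in>{- int n..<x}. color n a y * of_bool (aztec_cell n a y))"

lemma row_excess_step:
  assumes "- int n \<le> x"
  shows "row_excess n (x + 1) y = row_excess n x y + color n x y * of_bool (aztec_cell n x y)"
  unfolding row_excess_def using assms by (rule sum_int_step)

context
  fixes n :: nat and T :: "(real \<times> real) set set"
  assumes tiling: "domino_tiling (aztec_diamond n) T"
begin

lemma flux_right:
  "flux n T (x + 1) y = flux n T x y + color n x y * of_bool (vdomino x (y - 1) \<in> T)"
proof (cases "- int n \<le> x")
  case True
  then show ?thesis unfolding flux_def by (rule sum_int_step)
next
  case False
  then have "vdomino x (y - 1) \<notin> T"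
    using tiling_cells(2)[OF tiling, of x "y - 1"] aztec_cell_bounds(1)[of n x "y - 1"] by blast
  then show ?thesis using False unfolding flux_def by simp
qed

text \<open>Sum the colours of the cells in row \<open>y\<close> left of \<open>x\<close>. A vertical domino contributes to
  the flux through the bottom or top line of the row, a horizontal domino lying on one side of
  \<open>x\<close> contributes two opposite colours, and only a horizontal domino across \<open>x\<close> remains.\<close>

lemma flux_conservation:
  assumes "- int n \<le> x"
  shows "flux n T x y - flux n T x (y + 1) - color n x y * of_bool (hdomino (x - 1) y \<in> T)
    = row_excess n x y"
  using assms
proof (induction x rule: int_ge_induct)
  case base
  have "hdomino (- int n - 1) y \<notin> T"
    using tiling_cells(1)[OF tiling, of "- int n - 1" y]
      aztec_cell_bounds(1)[of n "- int n - 1" y] by auto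
  then show ?case by (simp add: flux_def row_excess_def)
next
  case (step x)
  have "color n x y * (of_bool (hdomino x y \<in> T) + of_bool (hdomino (x - 1) y \<in> T)
      + of_bool (vdomino x y \<in> T) + of_bool (vdomino x (y - 1) \<in> T))
    = color n x y * of_bool (aztec_cell n x y)"
    by (simp only: cell_covered_once[OF tiling])
  moreover have "flux n T (x + 1) (y + 1)
    = flux n T x (y + 1) - color n x y * of_bool (vdomino x y \<in> T)"
    using flux_right[of x "y + 1"] by simp
  ultimately show ?case
    using step.IH
    unfolding flux_right[of x y] row_excess_step[OF step.hyps] distrib_left color_shift
    by simp
qed

end

text \<open>Along a row the colours alternate, so the imbalance alternates between 0 and the colour of
  the first cell, which is 1 in the upper half and -1 in the lower half, that is,
  \<open>\<bar>y + 1\<bar> - \<bar>y\<bar>\<close>.\<close>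

lemma row_excess_closed_form:
  assumes "2 * \<bar>x\<bar> + \<bar>2 * y + 1\<bar> \<le> 2 * int n + 1"
  shows "2 * row_excess n x y
    = \<bar>y + 1\<bar> - \<bar>y\<bar> - color n x y"
proof -
  \<comment> \<open>The left end of row \<open>y\<close>; its right end is \<open>- l\<close>.\<close>
  define l where "l = (if y \<ge> 0 then y - int n else - int n - 1 - y)"
  have "l \<le> x" using assms unfolding l_def by auto
  then have "x \<le> - l \<longrightarrow> ?thesis"
  proof (induction x rule: int_ge_induct)
    case base
    have "row_excess n l y = 0"
      unfolding row_excess_def
      by (rule sum.neutral) (auto simp: aztec_cell_def l_def)
    moreover have "color n l y = \<bar>y + 1\<bar> - \<bar>y\<bar>"
      unfolding color_def l_def by auto
    ultimately show ?case by simp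
  next
    case (step x)
    show ?case
    proof
      assume "x + 1 \<le> - l"
      moreover from this step.hyps have "aztec_cell n x y"
        unfolding aztec_cell_def l_def by (auto split: if_splits)
      moreover have "- int n \<le> x" using step.hyps calculation(1) unfolding l_def by (auto split: if_splits)
      ultimately show "2 * row_excess n (x + 1) y
        = \<bar>y + 1\<bar> - \<bar>y\<bar> - color n (x + 1) y"
        using step.IH by (simp add: row_excess_step)
    qed
  qed
  moreover have "x \<le> - l" using assms unfolding l_def by auto
  ultimately show ?thesis by blast
qed

text \<open>Twice the classical height function of a domino tiling, which keeps it integral. The terms
  \<open>4 * \<bar>y\<bar> + color n x y\<close> are determined by the requirement that following an edge changes the
  height by \<open>\<plusminus>2\<close> if no domino straddles it and by \<open>\<minusplus>6\<close> otherwise: the first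
  absorbs the imbalance of the rows, the second the local chessboard pattern.\<close>

definition height :: "nat \<Rightarrow> (real \<times> real) set set \<Rightarrow> int \<Rightarrow> int \<Rightarrow> int" where
  "height n T x y = 8 * flux n T x y + 4 * \<bar>y\<bar> + color n x y"

lemma height_right:
  assumes "domino_tiling (aztec_diamond n) T"
  shows "height n T (x + 1) y = height n T x y
    - 2 * color n x y * (1 - 4 * of_bool (vdomino x (y - 1) \<in> T))"
  unfolding height_def using flux_right[OF assms, of x y] by (simp add: algebra_simps)

lemma height_up:
  assumes "domino_tiling (aztec_diamond n) T"
    and "2 * \<bar>x\<bar> + \<bar>2 * y + 1\<bar> \<le> 2 * int n + 1"
  shows "height n T x (y + 1) = height n T x y
    + 2 * color n x y * (1 - 4 * of_bool (hdomino (x - 1) y \<in> T))"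
proof -
  have "- int n \<le> x" using assms(2) by linarith
  from flux_conservation[OF assms(1) this, of y] row_excess_closed_form[OF assms(2)]
  show ?thesis unfolding height_def by (simp add: algebra_simps)
qed

lemma flux_diff_up:
  assumes "domino_tiling (aztec_diamond n) T" "domino_tiling (aztec_diamond n) T'" "- int n \<le> x"
  shows "flux n T x (y + 1) - flux n T' x (y + 1) = flux n T x y - flux n T' x y
    - color n x y * (of_bool (hdomino (x - 1) y \<in> T) - of_bool (hdomino (x - 1) y \<in> T'))"
  using flux_conservation[OF assms(1,3), of y] flux_conservation[OF assms(2,3), of y]
  by (simp add: algebra_simps)

text \<open>At the right end of the rows no horizontal domino straddles a vertical edge, so the difference
  is the same at all levels; above the diamond both fluxes are 0.\<close>

lemma flux_diff_row_total:
  assumes T: "domino_tiling (aztec_diamond n) T" and T': "domino_tiling (aztec_diamond n) T'"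
  shows "flux n T (int n) y = flux n T' (int n) y"
proof -
  let ?D = "\<lambda>y. flux n T (int n) y - flux n T' (int n) y"
  have const: "?D (y + 1) = ?D y" for y
  proof -
    have "hdomino (int n - 1) y \<notin> S" if "domino_tiling (aztec_diamond n) S" for S
      using tiling_cells(1)[OF that, of "int n - 1" y]
        aztec_cell_bounds(2)[of n "int n" y] by auto
    with flux_diff_up[OF T T', of "int n" y] T T' show ?thesis by simp
  qed
  have top: "?D z = 0" if "int n \<le> z" for z
  proof -
    have "vdomino a (z - 1) \<notin> S" if "domino_tiling (aztec_diamond n) S" for S a
      using tiling_cells(2)[OF that, of a "z - 1"] \<open>int n \<le> z\<close>
        aztec_cell_bounds(4)[of n a z] by auto
    then show ?thesis using T T' unfolding flux_def by simp
  qed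
  have shift: "?D (y + int k) = ?D y" for k
  proof (induction k)
    case (Suc k)
    then show ?case using const[of "y + int k"] by (simp add: algebra_simps)
  qed simp
  have "?D (y + int (nat (int n - y))) = 0" by (rule top) simp
  then show ?thesis using shift[of "nat (int n - y)"] by simp
qed

lemma flux_const_right:
  assumes T: "domino_tiling (aztec_diamond n) T" and "x \<le> x'"
    and "\<And>a. x \<le> a \<Longrightarrow> a < x' \<Longrightarrow> vdomino a (y - 1) \<notin> T"
  shows "flux n T x' y = flux n T x y"
  using assms(2,3)
proof (induction x' rule: int_ge_induct)
  case (step x')
  then show ?case using flux_right[OF T, of x' y] by simp
qed simp

text \<open>The rows of the diamond are symmetric intervals. Hence if one of the four cells around
  \<open>(x, y)\<close> is missing, either no vertical domino crosses the line to the left of the vertex, and both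
  fluxes vanish, or none crosses it to the right, and both fluxes equal their row totals.\<close>

lemma flux_diff_support:
  assumes T: "domino_tiling (aztec_diamond n) T" and T': "domino_tiling (aztec_diamond n) T'"
    and neq: "flux n T x y \<noteq> flux n T' x y"
    and ij: "i = x - 1 \<or> i = x" "j = y - 1 \<or> j = y"
  shows "aztec_cell n i j"
proof (rule ccontr)
  assume out: "\<not> aztec_cell n i j"
  have no_v: "vdomino a (y - 1) \<notin> S"
    if "domino_tiling (aztec_diamond n) S" "\<bar>2 * a + 1\<bar> \<ge> \<bar>2 * i + 1\<bar>" for S a
    using tiling_cells(2)[OF that(1), of a "y - 1"] aztec_cell_mono[OF _ that(2)] out ij(2) by auto
  show False
  proof (cases "i < 0")
    case True
    have "flux n S x y = 0" if S: "domino_tiling (aztec_diamond n) S" for S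
      unfolding flux_def
    proof (rule sum.neutral, rule ballI)
      fix a assume "a \<in> {- int n..<x}"
      then have "vdomino a (y - 1) \<notin> S"
        using True ij(1) by (intro no_v[OF S]) auto
      then show "color n a y * of_bool (vdomino a (y - 1) \<in> S) = 0" by simp
    qed
    then show False using neq T T' by simp
  next
    case False
    have "flux n S x y = flux n S (int n) y" if S: "domino_tiling (aztec_diamond n) S" for S
    proof -
      have "flux n S (max x (int n)) y = flux n S x y"
        by (rule flux_const_right[OF S])
          (use False ij(1) in \<open>auto intro!: no_v[OF S]\<close>)
      moreover have "flux n S (max x (int n)) y = flux n S (int n) y"
        by (rule flux_const_right[OF S])
          (auto dest!: tiling_cells(2)[OF S] aztec_cell_bounds(2))
      ultimately show ?thesis by simp
    qed
    then show False using neq flux_diff_row_total[OF T T', of y] T T' by simp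
  qed
qed

lemma tiling_eq_if_flux_eq:
  assumes T: "domino_tiling (aztec_diamond n) T" and T': "domino_tiling (aztec_diamond n) T'"
    and eq: "\<And>x y. flux n T x y = flux n T' x y"
  shows "T = T'"
proof -
  have v: "vdomino a b \<in> T \<longleftrightarrow> vdomino a b \<in> T'" for a b
    using flux_right[OF T, of a "b + 1"] flux_right[OF T', of a "b + 1"] eq
    by (auto simp: color_def of_bool_def split: if_splits)
  have h: "hdomino a b \<in> T \<longleftrightarrow> hdomino a b \<in> T'" for a b
  proof (cases "- int n \<le> a + 1")
    case True
    from flux_diff_up[OF T T' this, of b] show ?thesis
      using eq by (auto simp: color_def of_bool_def split: if_splits)
  next
    case False
    then show ?thesis using tiling_cells(1)[OF T, of a b] tiling_cells(1)[OF T', of a b]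
        aztec_cell_bounds(1)[of n "a + 1" b] by auto
  qed
  have "d \<in> T \<longleftrightarrow> d \<in> T'" if "d \<in> dominoes" for d
    using that by (cases rule: dominoes_cases) (auto simp: v h)
  then show ?thesis using T T' unfolding domino_tiling_def by blast
qed

section \<open>Flipping at a highest vertex\<close>

text \<open>The two vertical dominoes of the block are adjacent, so their contributions to the flux
  cancel beyond the center \<open>(x, y)\<close>. The colour condition fixes the direction of the
  rotation so that the flux at the center decreases.\<close>

lemma flux_block_flip:
  assumes T: "domino_tiling (aztec_diamond n) T"
    and T1: "domino_tiling (aztec_diamond n) T1"
    and PQ: "color n x y = 1 \<and> P = hpair (x - 1) (y - 1) \<and> Q = vpair (x - 1) (y - 1) \<or>
      color n x y = - 1 \<and> P = vpair (x - 1) (y - 1) \<and> Q = hpair (x - 1) (y - 1)"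
    and P: "P \<subseteq> T" and Q: "Q \<inter> T = {}" and T1_eq: "T1 = (T - P) \<union> Q"
  shows "flux n T1 x' y' = flux n T x' y' - of_bool (x' = x \<and> y' = y)"
proof -
  have T1_iff: "vdomino a (y' - 1) \<in> T1 \<longleftrightarrow>
      (if (a = x - 1 \<or> a = x) \<and> y' = y then color n x y = 1 else vdomino a (y' - 1) \<in> T)"
    and T_iff: "(a = x - 1 \<or> a = x) \<and> y' = y \<Longrightarrow>
      vdomino a (y' - 1) \<in> T \<longleftrightarrow> color n x y = - 1" for a
    using PQ P Q unfolding T1_eq by (elim disjE; force simp: hpair_def vpair_def)+
  have v: "color n a y' * of_bool (vdomino a (y' - 1) \<in> T1)
    = color n a y' * of_bool (vdomino a (y' - 1) \<in> T)
      - of_bool (a = x - 1 \<and> y' = y) + of_bool (a = x \<and> y' = y)" for a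
  proof (cases "(a = x - 1 \<or> a = x) \<and> y' = y")
    case True
    then show ?thesis using PQ unfolding T1_iff T_iff[OF True] by auto
  next
    case False
    then show ?thesis unfolding T1_iff by auto
  qed
  have "aztec_cell n (x - 1) (y - 1)"
    using PQ P tiling_cells[OF T, of "x - 1" "y - 1"] by (auto simp: hpair_def vpair_def)
  then have x: "- int n < x" using aztec_cell_bounds(1)[of n "x - 1" "y - 1"] by simp
  show ?thesis
  proof (cases "- int n \<le> x'")
    case True
    then show ?thesis
    proof (induction x' rule: int_ge_induct)
      case base
      show ?case using x by (simp add: flux_def)
    next
      case (step x')
      show ?case unfolding flux_right[OF T1] flux_right[OF T] step.IH v by auto
    qed
  next
    case False
    then show ?thesis using x by (simp add: flux_def)
  qed
qed

definition flux_distance :: "nat \<Rightarrow> (real \<times> real) set set \<Rightarrow> (real \<times> real) set set \<Rightarrow> nat" where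
  "flux_distance n T T' =
    (\<Sum>(x, y)\<in>{- int n..int n} \<times> {- int n..int n}. nat \<bar>flux n T x y - flux n T' x y\<bar>)"

lemma flux_distance_commute: "flux_distance n T T' = flux_distance n T' T"
  unfolding flux_distance_def by (simp add: abs_minus_commute)

text \<open>At a vertex of colour 1 the two vertical edges are the ones along which an unstraddled step
  goes up, at a vertex of colour -1 the two horizontal ones. By maximality each of these is
  straddled by a domino of \<open>T\<close>: an edge that is not straddled would lead to a higher vertex at which the flux of
  \<open>T\<close> still exceeds that of \<open>T'\<close>.\<close>

lemma highest_vertex_block:
  assumes T: "domino_tiling (aztec_diamond n) T" and T': "domino_tiling (aztec_diamond n) T'"
    and pos: "flux n T x y > flux n T' x y"
    and highest: "\<And>x' y'. flux n T x' y' > flux n T' x' y' \<Longrightarrow> height n T x' y' \<le> height n T x y"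
  shows "color n x y = 1 \<and> hpair (x - 1) (y - 1) \<subseteq> T \<or>
    color n x y = - 1 \<and> vpair (x - 1) (y - 1) \<subseteq> T"
proof -
  have cells: "aztec_cell n x y" "aztec_cell n (x - 1) y"
    "aztec_cell n x (y - 1)" "aztec_cell n (x - 1) (y - 1)"
    using flux_diff_support[OF T T', of x y] pos by auto
  note rows = inner_edge_bound[OF cells(1,2)] inner_edge_bound[OF cells(3,4)]
  have x: "- int n \<le> x" using aztec_cell_bounds(1)[OF cells(1)] .
  have "color n x y = 1 \<or> color n x y = - 1" unfolding color_def by auto
  then show ?thesis
  proof
    assume c: "color n x y = 1"
    have "hdomino (x - 1) y \<in> T"
    proof (rule ccontr)
      assume no: "hdomino (x - 1) y \<notin> T"
      have "height n T x (y + 1) > height n T x y"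
        using height_up[OF T rows(1)] c no by simp
      moreover have "flux n T x (y + 1) > flux n T' x (y + 1)"
        using flux_diff_up[OF T T' x, of y] c no pos
        by (cases "hdomino (x - 1) y \<in> T'") simp_all
      ultimately show False using highest[of "x" "y + 1"] by simp
    qed
    moreover have "hdomino (x - 1) (y - 1) \<in> T"
    proof (rule ccontr)
      assume no: "hdomino (x - 1) (y - 1) \<notin> T"
      have "height n T x (y - 1) > height n T x y"
        using height_up[OF T rows(2)] c no by simp
      moreover have "flux n T x (y - 1) > flux n T' x (y - 1)"
        using flux_diff_up[OF T T' x, of "y - 1"] c no pos
        by (cases "hdomino (x - 1) (y - 1) \<in> T'") simp_all
      ultimately show False using highest[of "x" "y - 1"] by simp
    qed
    ultimately show ?thesis using c by (simp add: hpair_def)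
  next
    assume c: "color n x y = - 1"
    have "vdomino x (y - 1) \<in> T"
    proof (rule ccontr)
      assume no: "vdomino x (y - 1) \<notin> T"
      have "height n T (x + 1) y > height n T x y"
        using height_right[OF T, of x y] c no by simp
      moreover have "flux n T (x + 1) y > flux n T' (x + 1) y"
        using flux_right[OF T, of x y] flux_right[OF T', of x y] c no pos
        by (cases "vdomino x (y - 1) \<in> T'") simp_all
      ultimately show False using highest[of "x + 1" "y"] by simp
    qed
    moreover have "vdomino (x - 1) (y - 1) \<in> T"
    proof (rule ccontr)
      assume no: "vdomino (x - 1) (y - 1) \<notin> T"
      have "height n T (x - 1) y > height n T x y"
        using height_right[OF T, of "x - 1" y] c no by simp
      moreover have "flux n T (x - 1) y > flux n T' (x - 1) y"
        using flux_right[OF T, of "x - 1" y] flux_right[OF T', of "x - 1" y] c no pos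
        by (cases "vdomino (x - 1) (y - 1) \<in> T'") simp_all
      ultimately show False using highest[of "x - 1" "y"] by simp
    qed
    ultimately show ?thesis using c by (simp add: vpair_def)
  qed
qed

text \<open>Since the two fluxes are integers, lowering the larger one by 1 at a vertex where they differ
  shortens the distance by exactly 1.\<close>

lemma move_closer:
  assumes T: "domino_tiling (aztec_diamond n) T" and T': "domino_tiling (aztec_diamond n) T'"
    and above: "flux n T x0 y0 > flux n T' x0 y0"
  obtains T1 where "elementary_move (aztec_diamond n) T T1" "elementary_move (aztec_diamond n) T1 T"
    "flux_distance n T1 T' < flux_distance n T T'"
proof -
  let ?B = "{- int n..int n} \<times> {- int n..int n}"
  define A where "A = {(x, y). flux n T x y > flux n T' x y}"
  have A_box: "A \<subseteq> ?B"
  proof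
    fix q assume "q \<in> A"
    moreover obtain x y where q: "q = (x, y)" by fastforce
    ultimately have "aztec_cell n x y"
      using flux_diff_support[OF T T', of x y] by (auto simp: A_def)
    then show "q \<in> ?B" using aztec_cell_bounds[of n x y] q by simp
  qed
  then have "finite A" by (rule finite_subset) simp
  moreover have "A \<noteq> {}" using above by (auto simp: A_def)
  ultimately have "Max ((\<lambda>(x, y). height n T x y) ` A) \<in> (\<lambda>(x, y). height n T x y) ` A"
    by (intro Max_in) auto
  then obtain x y where xy: "(x, y) \<in> A"
    and max: "height n T x y = Max ((\<lambda>(x, y). height n T x y) ` A)" by force
  have highest: "height n T x' y' \<le> height n T x y" if "(x', y') \<in> A" for x' y'
    unfolding max using \<open>finite A\<close> that by (intro Max_ge) force+
  have pos: "flux n T x y > flux n T' x y" using xy by (simp add: A_def)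
  have "color n x y = 1 \<and> hpair (x - 1) (y - 1) \<subseteq> T \<or>
    color n x y = - 1 \<and> vpair (x - 1) (y - 1) \<subseteq> T"
    by (rule highest_vertex_block[OF T T' pos]) (simp add: highest A_def)
  then obtain P Q where PQ:
    "color n x y = 1 \<and> P = hpair (x - 1) (y - 1) \<and> Q = vpair (x - 1) (y - 1) \<or>
      color n x y = - 1 \<and> P = vpair (x - 1) (y - 1) \<and> Q = hpair (x - 1) (y - 1)"
    and P: "P \<subseteq> T" by blast
  define T1 where "T1 = (T - P) \<union> Q"
  have PQ': "P = hpair (x - 1) (y - 1) \<and> Q = vpair (x - 1) (y - 1) \<or>
    P = vpair (x - 1) (y - 1) \<and> Q = hpair (x - 1) (y - 1)"
    using PQ by argo
  have moves: "elementary_move (aztec_diamond n) T T1" "elementary_move (aztec_diamond n) T1 T"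
    and Q: "Q \<inter> T = {}"
    unfolding T1_def by (rule flip_moves[OF T PQ' P])+
  have T1: "domino_tiling (aztec_diamond n) T1" using moves(1) unfolding elementary_move_def by blast
  have flux1: "flux n T1 x' y' = flux n T x' y' - of_bool (x' = x \<and> y' = y)" for x' y'
    by (rule flux_block_flip[OF T T1 PQ P Q T1_def])
  have "flux_distance n T1 T' < flux_distance n T T'"
    unfolding flux_distance_def
  proof (rule sum_strict_mono_ex1)
    show "\<forall>q\<in>?B. (case q of (x, y) \<Rightarrow> nat \<bar>flux n T1 x y - flux n T' x y\<bar>)
      \<le> (case q of (x, y) \<Rightarrow> nat \<bar>flux n T x y - flux n T' x y\<bar>)"
      using pos by (auto simp: flux1)
    show "\<exists>q\<in>?B. (case q of (x, y) \<Rightarrow> nat \<bar>flux n T1 x y - flux n T' x y\<bar>)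
      < (case q of (x, y) \<Rightarrow> nat \<bar>flux n T x y - flux n T' x y\<bar>)"
      using A_box xy pos by (intro bexI[of _ "(x, y)"]) (auto simp: flux1)
  qed simp
  with moves that show thesis by blast
qed

theorem mainTheorem2:
  fixes n :: nat and T T' :: "(real \<times> real) set set"
  assumes "n \<ge> 1"
    and "domino_tiling (aztec_diamond n) T"
    and "domino_tiling (aztec_diamond n) T'"
  shows "(elementary_move (aztec_diamond n))\<^sup>*\<^sup>* T T'"
  using assms(2,3)
proof (induction "flux_distance n T T'" arbitrary: T T' rule: less_induct)
  case less
  note T = less.prems(1) and T' = less.prems(2)
  consider x y where "flux n T x y > flux n T' x y" | x y where "flux n T' x y > flux n T x y"
    | "\<And>x y. flux n T x y = flux n T' x y"
    by (metis linorder_neqE)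
  then show ?case
  proof cases
    case 1
    obtain T1 where T1: "elementary_move (aztec_diamond n) T T1"
      "flux_distance n T1 T' < flux_distance n T T'"
      using move_closer[OF T T' 1] by blast
    have "domino_tiling (aztec_diamond n) T1" using T1(1) unfolding elementary_move_def by blast
    then have "(elementary_move (aztec_diamond n))\<^sup>*\<^sup>* T1 T'"
      using less.hyps[OF T1(2)] T' by blast
    then show ?thesis using T1(1) by (rule converse_rtranclp_into_rtranclp[rotated])
  next
    case 2
    obtain T1 where T1: "elementary_move (aztec_diamond n) T1 T'"
      "flux_distance n T1 T < flux_distance n T' T"
      using move_closer[OF T' T 2] by blast
    have "domino_tiling (aztec_diamond n) T1" using T1(1) unfolding elementary_move_def by blast
    then have "(elementary_move (aztec_diamond n))\<^sup>*\<^sup>* T T1"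
      using less.hyps[of T T1] T1(2) T by (simp add: flux_distance_commute)
    then show ?thesis using T1(1) by (rule rtranclp.rtrancl_into_rtrancl)
  next
    case 3
    then show ?thesis using tiling_eq_if_flux_eq[OF T T'] by simp
  qed
qed

end
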